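(* Let $\alpha,\beta$ be complex parameters with $\alpha q^i\neq 1$ for all $i\ge 1$. For every integer $n\ge 0$, the homogeneous little $q$-Jacobi polynomial $p_n^{(\alpha,\beta)}(x,y)$ satisfies the $q$-partial differential equation $$\mathcal{D}_{q,x}(1-\alpha\eta_x)\bigl\{p_n^{(\alpha,\beta)}(x,y)\bigr\}=-q\,\mathcal{D}_{q,y}(\eta_y^{-1}-q\alpha\beta\eta_x^2)\bigl\{p_n^{(\alpha,\beta)}(x,y)\bigr\},$$ that is, $$\mathcal{D}_{q,x}\bigl\{p_n^{(\alpha,\beta)}(x,y)-\alpha p_n^{(\alpha,\beta)}(qx,y)\bigr\}=-q\,\mathcal{D}_{q,y}\bigl\{p_n^{(\alpha,\beta)}(x,y/q)-q\alpha\beta\, p_n^{(\alpha,\beta)}(q^2x,y)\bigr\}.$$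
   Context: Fix $q$ with $0<|q|<1$. $(a;q)_0=1$, $(a;q)_n=\prod_{i=0}^{n-1}(1-aq^i)$, and $\begin{bmatrix} n\\ k\end{bmatrix}=\frac{(q;q)_n}{(q;q)_k(q;q)_{n-k}}$. The homogeneous little $q$-Jacobi polynomials are $$p_n^{(\alpha,\beta)}(x,y)=\sum_{k=0}^n q^{k(k+1-2n)/2}\begin{bmatrix} n\\ k\end{bmatrix}\frac{(\alpha\beta q^{n+1};q)_k}{(\alpha q;q)_k}(-x)^k y^{n-k}.$$ The $q$-partial derivative in a variable $x$ (other variables held constant) is $\mathcal{D}_{q,x}\{f\}=\frac{f(x)-f(qx)}{x}$ (for polynomials extended to $x=0$ in the obvious way). The $q$-shift operator $\eta_x^r$ replaces $x$ by $q^r x$. A product of operators is composition. *)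

theory Defs
  imports Complex_Main
begin

definition q_poch :: "complex \<Rightarrow> complex \<Rightarrow> nat \<Rightarrow> complex" where
  "q_poch a q n = (\<Prod>i<n. 1 - a * q ^ i)"

text \<open>Only meaningful for \<open>k \<le> n\<close>: the subtraction is truncated.\<close>
definition q_binom :: "complex \<Rightarrow> nat \<Rightarrow> nat \<Rightarrow> complex" where
  "q_binom q n k = q_poch q q n / (q_poch q q k * q_poch q q (n - k))"

text \<open>The exponent \<open>k (k + 1 - 2 n) / 2\<close> is a possibly negative integer, and the
  division is exact since \<open>k (k + 1)\<close> is even.\<close>
definition little_q_jacobi ::
    "complex \<Rightarrow> complex \<Rightarrow> complex \<Rightarrow> nat \<Rightarrow> complex \<Rightarrow> complex \<Rightarrow> complex" where
  "little_q_jacobi q \<alpha> \<beta> n x y =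
     (\<Sum>k=0..n. q powi ((int k * (int k + 1 - 2 * int n)) div 2) * q_binom q n k *
        (q_poch (\<alpha> * \<beta> * q ^ (n + 1)) q k / q_poch (\<alpha> * q) q k) * (- x) ^ k * y ^ (n - k))"

text \<open>At \<open>0\<close> the quotient is replaced by its limit; for a polynomial \<open>f\<close> the result is
  the polynomial \<open>(f x - f (q x)) / x\<close> (see \<open>q_diff_polynomial\<close>).\<close>
definition q_diff :: "complex \<Rightarrow> (complex \<Rightarrow> complex) \<Rightarrow> complex \<Rightarrow> complex" where
  "q_diff q f x =
     (if x = 0 then Lim (at 0) (\<lambda>t. (f t - f (q * t)) / t) else (f x - f (q * x)) / x)"

text \<open>Operators act on functions of two variables; the first argument plays the role of
  \<open>x\<close> and the second that of \<open>y\<close>.\<close>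
type_synonym fun2 = "complex \<Rightarrow> complex \<Rightarrow> complex"

definition q_diff_x :: "complex \<Rightarrow> fun2 \<Rightarrow> fun2" where
  "q_diff_x q F = (\<lambda>x y. q_diff q (\<lambda>t. F t y) x)"

definition q_diff_y :: "complex \<Rightarrow> fun2 \<Rightarrow> fun2" where
  "q_diff_y q F = (\<lambda>x y. q_diff q (\<lambda>t. F x t) y)"

definition q_shift_x :: "complex \<Rightarrow> int \<Rightarrow> fun2 \<Rightarrow> fun2" where
  "q_shift_x q r F = (\<lambda>x y. F (q powi r * x) y)"

definition q_shift_y :: "complex \<Rightarrow> int \<Rightarrow> fun2 \<Rightarrow> fun2" where
  "q_shift_y q r F = (\<lambda>x y. F x (q powi r * y))"

lemma q_diff_polynomial:
  "q_diff q (\<lambda>x. \<Sum>k\<le>n. c k * x ^ k) x = (\<Sum>k\<le>n. c k * (1 - q ^ k) * x ^ (k - 1))"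
proof -
  let ?f = "\<lambda>x. \<Sum>k\<le>n. c k * x ^ k" and ?g = "\<lambda>x. \<Sum>k\<le>n. c k * (1 - q ^ k) * x ^ (k - 1)"
  have quot: "(?f t - ?f (q * t)) / t = ?g t" if "t \<noteq> 0" for t
  proof -
    have "(c k * t ^ k - c k * (q * t) ^ k) / t = c k * (1 - q ^ k) * t ^ (k - 1)" for k
      using that by (cases k) (simp_all add: field_simps)
    then show ?thesis
      by (simp flip: sum_subtractf add: sum_divide_distrib)
  qed
  have "isCont ?g 0"
    by (intro continuous_intros)
  then have "(?g \<longlongrightarrow> ?g 0) (at 0)"
    by (simp add: isCont_def)
  then have "((\<lambda>t. (?f t - ?f (q * t)) / t) \<longlongrightarrow> ?g 0) (at 0)"
    by (rule Lim_transform_eventually) (auto simp: eventually_at_filter quot)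
  then have "Lim (at 0) (\<lambda>t. (?f t - ?f (q * t)) / t) = ?g 0"
    by (intro tendsto_Lim) simp_all
  then show ?thesis
    unfolding q_diff_def using quot by (cases "x = 0") (simp_all only: if_True if_False simp_thms)
qed

end

theory Submission
  imports Defs
begin

text \<open>Every monomial x^k y^(n-k) is an eigenvector of the shifts: 1 - \<alpha> eta_x
  multiplies it by 1 - \<alpha> q^k, and eta_y^(-1) - q \<alpha> \<beta> eta_x^2 by q^(-(n-k)) -
  \<alpha> \<beta> q^(2k+1). The q-derivatives in x and y then lower one exponent, with factors 1 -
  q^k and 1 - q^(n-k). Both sides are thus combinations of x^k y^(n-k-1) with k < n, and comparing
  coefficients turns the equation into a first-order recurrence for \<open>jacobi_coeff\<close>.
  That recurrence, \<open>jacobi_coeff_Suc\<close>, holds because the coefficients are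
  q-hypergeometric: the ratio of neighbours is the product of the ratios of the power of q, the
  q-binomial, the Pochhammer quotient and the sign.\<close>

definition jacobi_coeff :: "complex \<Rightarrow> complex \<Rightarrow> complex \<Rightarrow> nat \<Rightarrow> nat \<Rightarrow> complex" where
  "jacobi_coeff q \<alpha> \<beta> n k =
     q powi ((int k * (int k + 1 - 2 * int n)) div 2) * q_binom q n k *
       (q_poch (\<alpha> * \<beta> * q ^ (n + 1)) q k / q_poch (\<alpha> * q) q k) * (- 1) ^ k"

lemma little_q_jacobi_eq:
  "little_q_jacobi q \<alpha> \<beta> n x y = (\<Sum>k\<le>n. jacobi_coeff q \<alpha> \<beta> n k * x ^ k * y ^ (n - k))"
  unfolding little_q_jacobi_def jacobi_coeff_def power_minus[of x]
  by (simp add: atLeast0AtMost mult_ac)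

lemma q_poch_Suc: "q_poch a q (Suc k) = q_poch a q k * (1 - a * q ^ k)"
  by (simp add: q_poch_def)

text \<open>Since |q| < 1, no positive power of q equals 1. This makes the denominators of the
  q-binomials genuine.\<close>

lemma q_poch_self_nonzero:
  assumes "norm q < 1"
  shows "q_poch q q k \<noteq> 0"
proof -
  have "q ^ Suc i \<noteq> 1" for i
    using assms power_Suc_less_one[of "norm q" i]
    by (metis less_irrefl norm_ge_zero norm_one norm_power power_less_one_iff zero_less_Suc)
  then show ?thesis
    by (simp add: q_poch_def)
qed

lemma q_binom_Suc:
  assumes "norm q < 1" and "k < n"
  shows "q_binom q n (Suc k) * (1 - q ^ Suc k) = q_binom q n k * (1 - q ^ (n - k))"
proof -
  have "n - k = Suc (n - Suc k)"
    using assms by simp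
  moreover have "q_poch q q (Suc k) \<noteq> 0" "q_poch q q (Suc (n - Suc k)) \<noteq> 0"
    using assms q_poch_self_nonzero by blast+
  ultimately show ?thesis
    by (simp add: q_binom_def q_poch_Suc divide_simps)
qed

lemma q_powi_exponent_Suc:
  fixes q :: complex
  assumes "q \<noteq> 0" and "k < n"
  shows "q powi ((int (Suc k) * (int (Suc k) + 1 - 2 * int n)) div 2) =
         q powi ((int k * (int k + 1 - 2 * int n)) div 2) * q / q ^ (n - k)"
proof -
  \<comment> \<open>The numerator changes by an even number, so \<open>div 2\<close> passes through
    the step without an appeal to parity.\<close>
  have "int (Suc k) * (int (Suc k) + 1 - 2 * int n) =
        int k * (int k + 1 - 2 * int n) + (1 - int (n - k)) * 2"
    using assms by (simp add: algebra_simps of_nat_diff)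
  then have exponent: "(int (Suc k) * (int (Suc k) + 1 - 2 * int n)) div 2 =
        (int k * (int k + 1 - 2 * int n)) div 2 + (1 - int (n - k))"
    by simp
  show ?thesis
    unfolding exponent using assms by (simp add: power_int_add power_int_diff del: of_nat_diff)
qed

text \<open>Comparison of the coefficients of x^k y^(n-k-1): on the left the term k+1 contributes,
  lowered in x; on the right the term k, lowered in y.\<close>

lemma jacobi_coeff_Suc:
  assumes "0 < norm q" and "norm q < 1" and "\<And>i::nat. i \<ge> 1 \<Longrightarrow> \<alpha> * q ^ i \<noteq> 1" and "k < n"
  shows "jacobi_coeff q \<alpha> \<beta> n (Suc k) * (1 - \<alpha> * q ^ Suc k) * (1 - q ^ Suc k) =
         - q * (jacobi_coeff q \<alpha> \<beta> n k * (1 / q ^ (n - k) - q * \<alpha> * \<beta> * (q\<^sup>2) ^ k) * (1 - q ^ (n - k)))"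
proof -
  have q: "q \<noteq> 0" using assms by auto
  have nz: "1 - \<alpha> * q ^ Suc k \<noteq> 0"
    using assms(3)[of "Suc k"] by simp
  define P B A where "P = q powi ((int k * (int k + 1 - 2 * int n)) div 2)"
    and "B = q_binom q n k" and "A = q_poch (\<alpha> * \<beta> * q ^ (n + 1)) q k / q_poch (\<alpha> * q) q k"
  \<comment> \<open>The hypothesis on \<alpha>, taken at i = k+1, allows the last factor of the
    denominator to be cancelled.\<close>
  have ratio: "q_poch (\<alpha> * \<beta> * q ^ (n + 1)) q (Suc k) / q_poch (\<alpha> * q) q (Suc k) *
      (1 - \<alpha> * q ^ Suc k) = A * (1 - \<alpha> * \<beta> * q ^ (n + 1) * q ^ k)"
    using nz by (simp add: A_def q_poch_Suc mult.assoc)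
  \<comment> \<open>The factor q^(-(n-k)) left over from the power of q turns the new Pochhammer
    factor into the eigenvalue of the operator in y, because n+1+k = (2k+1) + (n-k).\<close>
  have exponent: "(1 - \<alpha> * \<beta> * q ^ (n + 1) * q ^ k) / q ^ (n - k) =
      1 / q ^ (n - k) - q * \<alpha> * \<beta> * (q\<^sup>2) ^ k"
  proof -
    have "q ^ (n + 1) * q ^ k = q * (q\<^sup>2) ^ k * q ^ (n - k)"
      using assms(4) by (simp add: add.commute flip: power_mult power_add power_Suc)
    then show ?thesis
      using q by (simp add: diff_divide_distrib mult.assoc)
  qed
  have "jacobi_coeff q \<alpha> \<beta> n (Suc k) * (1 - \<alpha> * q ^ Suc k) * (1 - q ^ Suc k) =
      (P * q / q ^ (n - k)) * (q_binom q n (Suc k) * (1 - q ^ Suc k)) *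
      (q_poch (\<alpha> * \<beta> * q ^ (n + 1)) q (Suc k) / q_poch (\<alpha> * q) q (Suc k) *
      (1 - \<alpha> * q ^ Suc k)) * (- 1) ^ Suc k"
    unfolding jacobi_coeff_def P_def q_powi_exponent_Suc[OF q assms(4)] by (simp only: mult_ac)
  also have "\<dots> = - q * ((P * B * A * (- 1) ^ k) *
      ((1 - \<alpha> * \<beta> * q ^ (n + 1) * q ^ k) / q ^ (n - k)) * (1 - q ^ (n - k)))"
    unfolding ratio q_binom_Suc[OF assms(2,4)] B_def by simp
  also have "P * B * A * (- 1) ^ k = jacobi_coeff q \<alpha> \<beta> n k"
    by (simp add: jacobi_coeff_def P_def A_def B_def)
  finally show ?thesis
    unfolding exponent .
qed

text \<open>Reversing the summation puts the powers of y in the order that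
  \<open>q_diff_polynomial\<close> expects; the value y = 0 is covered as well.\<close>

lemma q_diff_polynomial_rev:
  "q_diff q (\<lambda>y. \<Sum>k\<le>n. c k * y ^ (n - k)) y =
   (\<Sum>k\<le>n. c k * (1 - q ^ (n - k)) * y ^ (n - k - 1))"
proof -
  have rev: "(\<Sum>k\<le>n. f k) = (\<Sum>k\<le>n. f (n - k))" for f :: "nat \<Rightarrow> complex"
    by (rule sum.reindex_bij_witness[of _ "\<lambda>k. n - k" "\<lambda>k. n - k"]) auto
  have "(\<lambda>y. \<Sum>k\<le>n. c k * y ^ (n - k)) = (\<lambda>y. \<Sum>k\<le>n. c (n - k) * y ^ k)"
    by (subst rev) simp
  then have "q_diff q (\<lambda>y. \<Sum>k\<le>n. c k * y ^ (n - k)) y =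
      (\<Sum>k\<le>n. c (n - k) * (1 - q ^ k) * y ^ (k - 1))"
    by (simp only: q_diff_polynomial)
  then show ?thesis
    by (subst rev) simp
qed

lemma little_q_jacobi_q_diff_equation:
  assumes "0 < norm q" and "norm q < 1" and "\<And>i::nat. i \<ge> 1 \<Longrightarrow> \<alpha> * q ^ i \<noteq> 1"
  shows "q_diff q (\<lambda>t. little_q_jacobi q \<alpha> \<beta> n t y
                         - \<alpha> * little_q_jacobi q \<alpha> \<beta> n (q * t) y) x
       = - q * q_diff q (\<lambda>t. little_q_jacobi q \<alpha> \<beta> n x (t / q)
                         - q * \<alpha> * \<beta> * little_q_jacobi q \<alpha> \<beta> n (q\<^sup>2 * x) t) y"
proof -
  let ?c = "jacobi_coeff q \<alpha> \<beta> n"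
  let ?d = "\<lambda>k. ?c k * (1 / q ^ (n - k) - q * \<alpha> * \<beta> * (q\<^sup>2) ^ k) * x ^ k"
  have "(\<lambda>t. little_q_jacobi q \<alpha> \<beta> n t y - \<alpha> * little_q_jacobi q \<alpha> \<beta> n (q * t) y) =
      (\<lambda>t. \<Sum>k\<le>n. (?c k * (1 - \<alpha> * q ^ k) * y ^ (n - k)) * t ^ k)"
    by (simp add: little_q_jacobi_eq sum_distrib_left power_mult_distrib algebra_simps flip: sum_subtractf)
  then have lhs: "q_diff q (\<lambda>t. little_q_jacobi q \<alpha> \<beta> n t y
        - \<alpha> * little_q_jacobi q \<alpha> \<beta> n (q * t) y) x =
      (\<Sum>k\<le>n. ?c k * (1 - \<alpha> * q ^ k) * y ^ (n - k) * (1 - q ^ k) * x ^ (k - 1))"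
    by (simp only: q_diff_polynomial)
  have "little_q_jacobi q \<alpha> \<beta> n x (t / q) - q * \<alpha> * \<beta> * little_q_jacobi q \<alpha> \<beta> n (q\<^sup>2 * x) t =
      (\<Sum>k\<le>n. ?d k * t ^ (n - k))" for t
    unfolding little_q_jacobi_eq sum_distrib_left sum_subtractf[symmetric]
    by (intro sum.cong refl) (simp add: power_mult_distrib power_divide algebra_simps)
  then have rhs: "q_diff q (\<lambda>t. little_q_jacobi q \<alpha> \<beta> n x (t / q)
        - q * \<alpha> * \<beta> * little_q_jacobi q \<alpha> \<beta> n (q\<^sup>2 * x) t) y =
      (\<Sum>k\<le>n. ?d k * (1 - q ^ (n - k)) * y ^ (n - k - 1))"
    by (simp only: q_diff_polynomial_rev)
  \<comment> \<open>The term k = 0, where the exponent k - 1 is truncated, vanishes through 1 - q^0;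
    the rest is shifted by one.\<close>
  have "(\<Sum>k\<le>n. ?c k * (1 - \<alpha> * q ^ k) * y ^ (n - k) * (1 - q ^ k) * x ^ (k - 1)) =
      (\<Sum>k<n. ?c (Suc k) * (1 - \<alpha> * q ^ Suc k) * (1 - q ^ Suc k) * (x ^ k * y ^ (n - k - 1)))"
    by (simp add: sum.atMost_shift mult_ac)
  also have "\<dots> = (\<Sum>k<n. - q * (?d k * (1 - q ^ (n - k)) * y ^ (n - k - 1)))"
  proof (intro sum.cong refl)
    fix k assume "k \<in> {..<n}"
    then show "?c (Suc k) * (1 - \<alpha> * q ^ Suc k) * (1 - q ^ Suc k) * (x ^ k * y ^ (n - k - 1)) =
        - q * (?d k * (1 - q ^ (n - k)) * y ^ (n - k - 1))"
      by (subst jacobi_coeff_Suc[OF assms]) (simp_all add: mult_ac)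
  qed
  \<comment> \<open>The added term k = n is zero, again through 1 - q^0.\<close>
  also have "\<dots> = - q * (\<Sum>k\<le>n. ?d k * (1 - q ^ (n - k)) * y ^ (n - k - 1))"
    unfolding sum_distrib_left by (simp flip: lessThan_Suc_atMost)
  finally show ?thesis
    unfolding lhs rhs .
qed

theorem proposition4p1:
  fixes q \<alpha> \<beta> :: complex and n :: nat
  assumes "0 < norm q" and "norm q < 1"
    and "\<And>i::nat. i \<ge> 1 \<Longrightarrow> \<alpha> * q ^ i \<noteq> 1"
  shows "(q_diff_x q \<circ> (\<lambda>F x y. F x y - \<alpha> * q_shift_x q 1 F x y)) (little_q_jacobi q \<alpha> \<beta> n)
       = (\<lambda>x y. - q * (q_diff_y q \<circ>
            (\<lambda>F x y. q_shift_y q (-1) F x y - q * \<alpha> * \<beta> * q_shift_x q 2 F x y))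
            (little_q_jacobi q \<alpha> \<beta> n) x y)
    \<and> (\<forall>x y. q_diff q (\<lambda>t. little_q_jacobi q \<alpha> \<beta> n t y
                         - \<alpha> * little_q_jacobi q \<alpha> \<beta> n (q * t) y) x
       = - q * q_diff q (\<lambda>t. little_q_jacobi q \<alpha> \<beta> n x (t / q)
                         - q * \<alpha> * \<beta> * little_q_jacobi q \<alpha> \<beta> n (q\<^sup>2 * x) t) y)"
  \<comment> \<open>Unfolding the operators gives the pointwise identity, with
    \<open>q powi (-1) * t\<close> read as \<open>t / q\<close>.\<close>
  using little_q_jacobi_q_diff_equation[OF assms]
  by (simp add: q_diff_x_def q_diff_y_def q_shift_x_def q_shift_y_def power_int_minus
      fun_eq_iff field_simps)

end
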